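(* Let $\mu_1,\mu_2$ be Radon probability measures on real Banach spaces $E_1,E_2$, respectively, with $\widehat{\mu_2}(x^* )\neq0$ for all $x^*\in E_2^*$. Suppose that the Borel mapping $T:E_1\to E_2$ is a skew map with respect to the pair $(\mu_1,\mu_2)$, and let $\rho$ be the associated skew convolution factor. Then for all $1\le p<\infty$ the linear mapping $P_T:B_{\rm b}(E_2)\to B_{\rm b}(E_1)$ defined by $$P_Tf(x):=\int_{E_2}f(T(x)+y)\,d\rho(y),\qquad x\in E_1,$$ extends uniquely to a linear contraction $P_T:L^p(E_2,\mu_2)\to L^p(E_1,\mu_1)$.
   Context: A Radon probability measure on a Banach space $E$ is a Borel probability measure $\nu$ such that for all $\varepsilon>0$ there is a compact $K\subseteq E$ with $\nu(E\setminus K)<\varepsilon$. Its characteristic function is $\widehat\nu(x^* )=\int_E\exp(i\langle x,x^*\rangle)\,\nu(dx)$, $x^*\in E^*$. $B_{\rm b}(E)$ is the space of bounded Borel measurable functions on $E$ (real- or complex-valued) with the supremum norm. $T(\mu_1)=\mu_1\circ T^{-1}$ is the image measure and $*$ is convolution of measures. A Borel mapping $T:E_1\to E_2$ is a skew map with respect to $(\mu_1,\mu_2)$ if there exists a Radon probability measure $\rho$ on $E_2$ with $T(\mu_1)*\rho=\mu_2$; since $\widehat{\mu_2}$ vanishes nowhere, $\rho$ is unique and is called the skew convolution factor associated with $T$ and $(\mu_1,\mu_2)$. *)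

theory Defs
  imports "HOL-Probability.Probability"
begin

subsection \<open>Radon probability measures and characteristic functions\<close>

definition radon_prob :: "'a::real_normed_vector measure \<Rightarrow> bool" where
  "radon_prob \<nu> \<longleftrightarrow> prob_space \<nu> \<and> sets \<nu> = sets borel \<and>
     (\<forall>\<epsilon>>0. \<exists>K. compact K \<and> measure \<nu> (UNIV - K) < \<epsilon>)"

definition char_fun :: "'a::real_normed_vector measure \<Rightarrow> ('a \<Rightarrow>\<^sub>L real) \<Rightarrow> complex" where
  "char_fun \<nu> x' = (\<integral>x. exp (\<i> * complex_of_real (blinfun_apply x' x)) \<partial>\<nu>)"

subsection \<open>Convolution\<close>

text \<open>
  The library's convolution is the image of the product measure under addition, and is
  restricted to \<^class>\<open>ordered_euclidean_space\<close>. On a non-separable Banach space addition need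
  not be measurable for the product of the Borel sigma-algebras, so convolution is given here
  by the formula \<open>(\<mu> * \<rho>)(A) = \<integral> \<rho>(A - x) d\<mu>(x)\<close>, whose integrand is always Borel measurable
  (\<open>measurable_emeasure_translate\<close>); \<open>conv_measure_eq_convolution\<close> shows that it agrees with
  the library's notion where the latter is available.
\<close>

definition conv_measure :: "'a::real_normed_vector measure \<Rightarrow> 'a measure \<Rightarrow> 'a measure" where
  "conv_measure \<mu> \<rho> =
     measure_of UNIV (sets borel) (\<lambda>A. \<integral>\<^sup>+x. emeasure \<rho> {y. x + y \<in> A} \<partial>\<mu>)"

lemma translate_sets_borel:
  fixes A :: "'a::real_normed_vector set"
  assumes "A \<in> sets borel"
  shows "{y. x + y \<in> A} \<in> sets borel"
proof -
  have "(\<lambda>y. x + y) \<in> borel_measurable (borel :: 'a measure)"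
    by (intro borel_measurable_continuous_onI continuous_intros)
  from measurable_sets[OF this assms] show ?thesis
    by (simp add: vimage_def)
qed

lemma measurable_emeasure_translate:
  fixes \<rho> :: "'a::real_normed_vector measure"
  assumes fin: "finite_measure \<rho>" and sets: "sets \<rho> = sets borel" and A: "A \<in> sets borel"
  shows "(\<lambda>x. emeasure \<rho> {y. x + y \<in> A}) \<in> borel_measurable borel"
proof -
  interpret finite_measure \<rho> by fact
  have space: "space \<rho> = UNIV"
    using sets_eq_imp_space_eq[OF sets] by simp
  have tr: "{y. x + y \<in> B} \<in> sets \<rho>" if "B \<in> sets borel" for x B
    using translate_sets_borel[OF that] by (simp add: sets)
  have "Int_stable {U :: 'a set. open U}"
    by (auto simp: Int_stable_def)
  moreover have "{U :: 'a set. open U} \<subseteq> Pow UNIV"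
    by simp
  moreover have "A \<in> sigma_sets UNIV {U :: 'a set. open U}"
    using A by (simp add: sets_borel)
  ultimately show ?thesis
  proof (induction rule: sigma_sets_induct_disjoint[consumes 3])
    case (basic U)
    then have U: "open U" by simp
    let ?g = "\<lambda>x. emeasure \<rho> {y. x + y \<in> U}"
    have "closed {x. ?g x \<le> a}" for a
      unfolding closed_sequential_limits
    proof (intro allI impI, elim conjE)
      fix X l assume X: "\<forall>n. X n \<in> {x. ?g x \<le> a}" and lim: "X \<longlonglongrightarrow> l"
      have ind: "indicator {y. l + y \<in> U} y \<le>
          liminf (\<lambda>n. indicator {y. X n + y \<in> U} y :: ennreal)" for y
      proof (cases "l + y \<in> U")
        case True
        have "(\<lambda>n. X n + y) \<longlonglongrightarrow> l + y"
          by (intro tendsto_intros lim)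
        then have "eventually (\<lambda>n. X n + y \<in> U) sequentially"
          using U True by (rule topological_tendstoD)
        then have "eventually (\<lambda>n. 1 \<le> (indicator {y. X n + y \<in> U} y :: ennreal)) sequentially"
          by eventually_elim simp
        then have "1 \<le> liminf (\<lambda>n. indicator {y. X n + y \<in> U} y :: ennreal)"
          by (rule Liminf_bounded)
        then show ?thesis using True by simp
      qed simp
      have "?g l = (\<integral>\<^sup>+y. indicator {y. l + y \<in> U} y \<partial>\<rho>)"
        using tr[of U l] U by simp
      also have "\<dots> \<le> (\<integral>\<^sup>+y. liminf (\<lambda>n. indicator {y. X n + y \<in> U} y) \<partial>\<rho>)"
        by (intro nn_integral_mono ind)
      also have "\<dots> \<le> liminf (\<lambda>n. \<integral>\<^sup>+y. indicator {y. X n + y \<in> U} y \<partial>\<rho>)"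
        using U by (intro nn_integral_liminf borel_measurable_indicator tr) simp
      also have "\<dots> = liminf (\<lambda>n. ?g (X n))"
        using tr[of U] U by simp
      also have "\<dots> \<le> a"
        using X by (intro Liminf_le) (auto intro!: always_eventually)
      finally show "l \<in> {x. ?g x \<le> a}" by simp
    qed
    moreover have "{x. a < ?g x} = UNIV - {x. ?g x \<le> a}" for a
      by auto
    ultimately have "open {x. a < ?g x}" for a
      by (metis Compl_eq_Diff_UNIV open_Compl)
    then show ?case
      by (intro borel_measurableI_greater) simp
  next
    case empty
    then show ?case by simp
  next
    case (compl B)
    then have B: "B \<in> sets borel" by (simp add: sets_borel)
    have "emeasure \<rho> {y. x + y \<in> UNIV - B} = emeasure \<rho> (space \<rho>) - emeasure \<rho> {y. x + y \<in> B}" for x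
    proof -
      have "{y. x + y \<in> UNIV - B} = space \<rho> - {y. x + y \<in> B}"
        by (auto simp: space)
      then show ?thesis
        using tr[OF B] by (simp add: emeasure_compl)
    qed
    then show ?case using compl.IH by simp
  next
    case (union B)
    then have B: "B i \<in> sets borel" for i by (auto simp: sets_borel)
    have "emeasure \<rho> {y. x + y \<in> (\<Union>i. B i)} = (\<Sum>i. emeasure \<rho> {y. x + y \<in> B i})" for x
    proof -
      have "disjoint_family (\<lambda>i. {y. x + y \<in> B i})"
        using union(1) by (auto simp: disjoint_family_on_def)
      moreover have "{y. x + y \<in> (\<Union>i. B i)} = (\<Union>i. {y. x + y \<in> B i})" by auto
      ultimately show ?thesis
        using tr[OF B] by (simp add: suminf_emeasure image_subset_iff)
    qed
    then show ?case using union.IH by simp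
  qed
qed

lemma space_conv_measure [simp]: "space (conv_measure \<mu> \<rho>) = UNIV"
  by (simp add: conv_measure_def space_measure_of_conv)

lemma sets_conv_measure [simp]: "sets (conv_measure \<mu> \<rho>) = sets borel"
  using sets.sigma_sets_eq[of borel] by (simp add: conv_measure_def)

lemma emeasure_conv_measure:
  fixes \<mu> \<rho> :: "'a::real_normed_vector measure"
  assumes fin: "finite_measure \<rho>" and sets: "sets \<mu> = sets borel" "sets \<rho> = sets borel"
    and A: "A \<in> sets borel"
  shows "emeasure (conv_measure \<mu> \<rho>) A = (\<integral>\<^sup>+x. emeasure \<rho> {y. x + y \<in> A} \<partial>\<mu>)"
proof (rule emeasure_measure_of[OF conv_measure_def])
  show "positive (sets (conv_measure \<mu> \<rho>)) (\<lambda>A. \<integral>\<^sup>+x. emeasure \<rho> {y. x + y \<in> A} \<partial>\<mu>)"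
    by (simp add: positive_def)
  show "countably_additive (sets (conv_measure \<mu> \<rho>)) (\<lambda>A. \<integral>\<^sup>+x. emeasure \<rho> {y. x + y \<in> A} \<partial>\<mu>)"
  proof (rule countably_additiveI)
    fix B :: "nat \<Rightarrow> 'a set"
    assume "range B \<subseteq> sets (conv_measure \<mu> \<rho>)" and disj: "disjoint_family B"
    then have B: "B i \<in> sets borel" for i by auto
    have "(\<lambda>x. emeasure \<rho> {y. x + y \<in> B i}) \<in> borel_measurable \<mu>" for i
      using measurable_emeasure_translate[OF fin sets(2) B]
      by (simp add: measurable_cong_sets[OF sets(1) refl])
    then have "(\<Sum>i. \<integral>\<^sup>+x. emeasure \<rho> {y. x + y \<in> B i} \<partial>\<mu>) =
        (\<integral>\<^sup>+x. (\<Sum>i. emeasure \<rho> {y. x + y \<in> B i}) \<partial>\<mu>)"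
      by (simp add: nn_integral_suminf)
    also have "\<dots> = (\<integral>\<^sup>+x. emeasure \<rho> {y. x + y \<in> (\<Union>i. B i)} \<partial>\<mu>)"
    proof (rule nn_integral_cong)
      fix x
      have "disjoint_family (\<lambda>i. {y. x + y \<in> B i})"
        using disj by (auto simp: disjoint_family_on_def)
      moreover have "{y. x + y \<in> (\<Union>i. B i)} = (\<Union>i. {y. x + y \<in> B i})" by auto
      ultimately show "(\<Sum>i. emeasure \<rho> {y. x + y \<in> B i}) = emeasure \<rho> {y. x + y \<in> (\<Union>i. B i)}"
        using translate_sets_borel[OF B] by (simp add: suminf_emeasure image_subset_iff sets)
    qed
    finally show "(\<Sum>i. \<integral>\<^sup>+x. emeasure \<rho> {y. x + y \<in> B i} \<partial>\<mu>) =
        (\<integral>\<^sup>+x. emeasure \<rho> {y. x + y \<in> (\<Union>i. B i)} \<partial>\<mu>)" .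
  qed
qed (use A in simp_all)

lemma conv_measure_eq_convolution:
  fixes \<mu> \<rho> :: "'a::ordered_euclidean_space measure"
  assumes "finite_measure \<mu>" "finite_measure \<rho>" and sets: "sets \<mu> = sets borel" "sets \<rho> = sets borel"
  shows "conv_measure \<mu> \<rho> = convolution \<mu> \<rho>"
proof (rule measure_eqI)
  fix A assume "A \<in> sets (conv_measure \<mu> \<rho>)"
  then have "A \<in> sets borel" by simp
  moreover have "space \<mu> = space \<rho>" "space \<rho> = space borel"
    using sets by (auto dest: sets_eq_imp_space_eq)
  ultimately show "emeasure (conv_measure \<mu> \<rho>) A = emeasure (convolution \<mu> \<rho>) A"
    using assms by (simp add: emeasure_conv_measure convolution_emeasure add.commute)
qed simp

subsection \<open>Skew maps\<close>

definition skew_factor ::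
    "('a::banach \<Rightarrow> 'b::banach) \<Rightarrow> 'a measure \<Rightarrow> 'b measure \<Rightarrow> 'b measure \<Rightarrow> bool" where
  "skew_factor T \<mu>\<^sub>1 \<mu>\<^sub>2 \<rho> \<longleftrightarrow> radon_prob \<rho> \<and> conv_measure (distr \<mu>\<^sub>1 borel T) \<rho> = \<mu>\<^sub>2"

definition skew_map ::
    "('a::banach \<Rightarrow> 'b::banach) \<Rightarrow> 'a measure \<Rightarrow> 'b measure \<Rightarrow> bool" where
  "skew_map T \<mu>\<^sub>1 \<mu>\<^sub>2 \<longleftrightarrow> T \<in> measurable borel borel \<and> (\<exists>\<rho>. skew_factor T \<mu>\<^sub>1 \<mu>\<^sub>2 \<rho>)"

subsection \<open>Bounded Borel functions and the operator\<close>

text \<open>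
  The scalars are a type \<open>'k\<close> of sort
  \<open>{real_normed_field, banach, second_countable_topology}\<close>. Both \<^typ>\<open>real\<close> and
  \<^typ>\<open>complex\<close> are instances, and by Gelfand-Mazur (the norm of a \<^class>\<open>real_normed_field\<close>
  is multiplicative) every instance is isometrically isomorphic to one of these.
\<close>

definition bounded_borel ::
    "('a::topological_space \<Rightarrow> 'k::{real_normed_field, banach, second_countable_topology}) set" where
  "bounded_borel = {f. f \<in> borel_measurable borel \<and> bounded (range f)}"

definition skew_op ::
    "('a \<Rightarrow> 'b::real_normed_vector) \<Rightarrow> 'b measure \<Rightarrow>
     ('b \<Rightarrow> 'k::{real_normed_field, banach, second_countable_topology}) \<Rightarrow> 'a \<Rightarrow> 'k" where
  "skew_op T \<rho> f = (\<lambda>x. \<integral>y. f (T x + y) \<partial>\<rho>)"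

subsection \<open>The spaces \<open>L\<^sup>p\<close>, as sets of almost-everywhere equivalence classes\<close>

definition lp_fun ::
    "real \<Rightarrow> 'a measure \<Rightarrow> ('a \<Rightarrow> 'k::{real_normed_field, banach, second_countable_topology}) set" where
  "lp_fun p M = {f. f \<in> borel_measurable M \<and> integrable M (\<lambda>x. norm (f x) powr p)}"

definition lp_rel ::
    "real \<Rightarrow> 'a measure \<Rightarrow>
     (('a \<Rightarrow> 'k::{real_normed_field, banach, second_countable_topology}) \<times> ('a \<Rightarrow> 'k)) set" where
  "lp_rel p M = {(f, g). f \<in> lp_fun p M \<and> g \<in> lp_fun p M \<and> (AE x in M. f x = g x)}"

definition Lp ::
    "real \<Rightarrow> 'a measure \<Rightarrow> ('a \<Rightarrow> 'k::{real_normed_field, banach, second_countable_topology}) set set" where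
  "Lp p M = lp_fun p M // lp_rel p M"

definition Lp_class ::
    "real \<Rightarrow> 'a measure \<Rightarrow> ('a \<Rightarrow> 'k::{real_normed_field, banach, second_countable_topology}) \<Rightarrow>
     ('a \<Rightarrow> 'k) set" where
  "Lp_class p M f = lp_rel p M `` {f}"

definition Lp_add ::
    "real \<Rightarrow> 'a measure \<Rightarrow> ('a \<Rightarrow> 'k::{real_normed_field, banach, second_countable_topology}) set \<Rightarrow>
     ('a \<Rightarrow> 'k) set \<Rightarrow> ('a \<Rightarrow> 'k) set" where
  "Lp_add p M F G = (\<Union>f\<in>F. \<Union>g\<in>G. Lp_class p M (\<lambda>x. f x + g x))"

definition Lp_scale ::
    "real \<Rightarrow> 'a measure \<Rightarrow> 'k \<Rightarrow>
     ('a \<Rightarrow> 'k::{real_normed_field, banach, second_countable_topology}) set \<Rightarrow> ('a \<Rightarrow> 'k) set" where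
  "Lp_scale p M c F = (\<Union>f\<in>F. Lp_class p M (\<lambda>x. c * f x))"

definition Lp_norm ::
    "real \<Rightarrow> 'a measure \<Rightarrow> ('a \<Rightarrow> 'k::{real_normed_field, banach, second_countable_topology}) set \<Rightarrow> real" where
  "Lp_norm p M F = the_elem ((\<lambda>f. (\<integral>x. norm (f x) powr p \<partial>M) powr (1 / p)) ` F)"

lemma equiv_lp_rel: "equiv (lp_fun p M) (lp_rel p M)"
proof (rule equivI)
  show "trans (lp_rel p M)"
  proof (rule transI)
    fix f g h
    assume fg: "(f, g) \<in> lp_rel p M" and gh: "(g, h) \<in> lp_rel p M"
    then have "AE x in M. f x = g x" "AE x in M. g x = h x"
      by (auto simp: lp_rel_def)
    then have "AE x in M. f x = h x"
      by eventually_elim simp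
    then show "(f, h) \<in> lp_rel p M"
      using fg gh by (auto simp: lp_rel_def)
  qed
qed (auto simp: lp_rel_def refl_on_def sym_def)

lemma lp_fun_add:
  fixes f g :: "'a \<Rightarrow> 'k::{real_normed_field, banach, second_countable_topology}"
  assumes p: "p \<ge> 0" and f: "f \<in> lp_fun p M" and g: "g \<in> lp_fun p M"
  shows "(\<lambda>x. f x + g x) \<in> lp_fun p M"
proof -
  have [measurable]: "f \<in> borel_measurable M" "g \<in> borel_measurable M"
    using f g by (auto simp: lp_fun_def)
  have le: "norm (f x + g x) powr p \<le> 2 powr p * (norm (f x) powr p + norm (g x) powr p)" for x
  proof -
    have "norm (f x + g x) \<le> 2 * max (norm (f x)) (norm (g x))"
      using norm_triangle_ineq[of "f x" "g x"] by linarith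
    then have "norm (f x + g x) powr p \<le> (2 * max (norm (f x)) (norm (g x))) powr p"
      using p by (intro powr_mono2) auto
    also have "\<dots> = 2 powr p * max (norm (f x)) (norm (g x)) powr p"
      by (rule powr_mult)
    also have "\<dots> \<le> 2 powr p * (norm (f x) powr p + norm (g x) powr p)"
      by (intro mult_left_mono) (auto simp: max_def)
    finally show ?thesis .
  qed
  have "integrable M (\<lambda>x. 2 powr p * (norm (f x) powr p + norm (g x) powr p))"
    using f g by (auto simp: lp_fun_def)
  then have "integrable M (\<lambda>x. norm (f x + g x) powr p)"
    by (rule Bochner_Integration.integrable_bound) (use le in auto)
  then show ?thesis by (simp add: lp_fun_def)
qed

lemma lp_fun_scale:
  fixes f :: "'a \<Rightarrow> 'k::{real_normed_field, banach, second_countable_topology}"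
  assumes f: "f \<in> lp_fun p M"
  shows "(\<lambda>x. c * f x) \<in> lp_fun p M"
  using f by (auto simp: lp_fun_def norm_mult powr_mult intro!: borel_measurable_times)

lemma Lp_class_in_Lp: "f \<in> lp_fun p M \<Longrightarrow> Lp_class p M f \<in> Lp p M"
  by (simp add: Lp_def Lp_class_def quotientI)

lemma Lp_class_eq_iff:
  assumes "f \<in> lp_fun p M" "g \<in> lp_fun p M"
  shows "Lp_class p M f = Lp_class p M g \<longleftrightarrow> (AE x in M. f x = g x)"
  using eq_equiv_class_iff[OF equiv_lp_rel assms] assms
  by (simp add: Lp_class_def lp_rel_def)

lemma mem_Lp_class_iff:
  "g \<in> Lp_class p M f \<longleftrightarrow> f \<in> lp_fun p M \<and> g \<in> lp_fun p M \<and> (AE x in M. f x = g x)"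
  by (simp add: Lp_class_def lp_rel_def)

lemma Lp_add_class:
  fixes f g :: "'a \<Rightarrow> 'k::{real_normed_field, banach, second_countable_topology}"
  assumes p: "p \<ge> 0" and f: "f \<in> lp_fun p M" and g: "g \<in> lp_fun p M"
  shows "Lp_add p M (Lp_class p M f) (Lp_class p M g) = Lp_class p M (\<lambda>x. f x + g x)"
proof -
  have "Lp_class p M (\<lambda>x. f' x + g' x) = Lp_class p M (\<lambda>x. f x + g x)"
    if "f' \<in> Lp_class p M f" "g' \<in> Lp_class p M g" for f' g'
  proof -
    from that have *: "f' \<in> lp_fun p M" "g' \<in> lp_fun p M"
      "AE x in M. f x = f' x" "AE x in M. g x = g' x"
      by (auto simp: mem_Lp_class_iff)
    from *(3,4) have "AE x in M. f' x + g' x = f x + g x"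
      by eventually_elim simp
    then show ?thesis
      using * p f g by (simp add: Lp_class_eq_iff lp_fun_add)
  qed
  moreover have "f \<in> Lp_class p M f" "g \<in> Lp_class p M g"
    using f g by (auto simp: mem_Lp_class_iff)
  ultimately show ?thesis unfolding Lp_add_def by blast
qed

lemma Lp_scale_class:
  fixes f :: "'a \<Rightarrow> 'k::{real_normed_field, banach, second_countable_topology}"
  assumes f: "f \<in> lp_fun p M"
  shows "Lp_scale p M c (Lp_class p M f) = Lp_class p M (\<lambda>x. c * f x)"
proof -
  have "Lp_class p M (\<lambda>x. c * f' x) = Lp_class p M (\<lambda>x. c * f x)"
    if "f' \<in> Lp_class p M f" for f'
  proof -
    from that have *: "f' \<in> lp_fun p M" "AE x in M. f x = f' x"
      by (auto simp: mem_Lp_class_iff)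
    from *(2) have "AE x in M. c * f' x = c * f x"
      by eventually_elim simp
    then show ?thesis
      using * f by (simp add: Lp_class_eq_iff lp_fun_scale)
  qed
  moreover have "f \<in> Lp_class p M f"
    using f by (auto simp: mem_Lp_class_iff)
  ultimately show ?thesis unfolding Lp_scale_def by blast
qed

lemma Lp_norm_class:
  fixes f :: "'a \<Rightarrow> 'k::{real_normed_field, banach, second_countable_topology}"
  assumes f: "f \<in> lp_fun p M"
  shows "Lp_norm p M (Lp_class p M f) = (\<integral>x. norm (f x) powr p \<partial>M) powr (1 / p)"
proof -
  have "(\<integral>x. norm (f' x) powr p \<partial>M) = (\<integral>x. norm (f x) powr p \<partial>M)"
    if "f' \<in> Lp_class p M f" for f'
  proof -
    from that have *: "f' \<in> lp_fun p M" "AE x in M. f x = f' x"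
      by (auto simp: mem_Lp_class_iff)
    have [measurable]: "f \<in> borel_measurable M" "f' \<in> borel_measurable M"
      using f * by (auto simp: lp_fun_def)
    show ?thesis
      by (rule integral_cong_AE) (use *(2) in auto)
  qed
  then have "(\<lambda>f. (\<integral>x. norm (f x) powr p \<partial>M) powr (1 / p)) ` Lp_class p M f =
      (\<lambda>_. (\<integral>x. norm (f x) powr p \<partial>M) powr (1 / p)) ` Lp_class p M f"
    by (intro image_cong refl arg_cong[where f = "\<lambda>t. t powr (1 / p)"])
  moreover have "f \<in> Lp_class p M f"
    using f by (auto simp: mem_Lp_class_iff)
  ultimately have "(\<lambda>f. (\<integral>x. norm (f x) powr p \<partial>M) powr (1 / p)) ` Lp_class p M f =
      {(\<integral>x. norm (f x) powr p \<partial>M) powr (1 / p)}"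
    by (simp only: image_constant)
  then show ?thesis by (simp add: Lp_norm_def)
qed

definition Lp_linear_contraction ::
    "real \<Rightarrow> 'a measure \<Rightarrow> 'b measure \<Rightarrow>
     (('a \<Rightarrow> 'k::{real_normed_field, banach, second_countable_topology}) set \<Rightarrow> ('b \<Rightarrow> 'k) set) \<Rightarrow> bool" where
  "Lp_linear_contraction p M N S \<longleftrightarrow>
     (\<forall>F\<in>Lp p M. S F \<in> Lp p N) \<and>
     (\<forall>F\<in>Lp p M. \<forall>G\<in>Lp p M. S (Lp_add p M F G) = Lp_add p N (S F) (S G)) \<and>
     (\<forall>c. \<forall>F\<in>Lp p M. S (Lp_scale p M c F) = Lp_scale p N c (S F)) \<and>
     (\<forall>F\<in>Lp p M. Lp_norm p N (S F) \<le> Lp_norm p M F)"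

end

theory Submission
  imports Defs
begin

text \<open>
  For the Markov kernel \<open>Q x\<close> = law of \<open>T x + Y\<close> with \<open>Y \<sim> \<rho>\<close>, the skew convolution identity says
  that \<open>\<mu>\<^sub>2 = \<mu>\<^sub>1 \<bind> Q\<close>, and \<open>P\<^sub>T f\<close> is \<open>x \<mapsto> \<integral> f dQ x\<close>. Jensen's inequality for each \<open>Q x\<close> gives
  \<open>|P\<^sub>T f|\<^sup>p \<le> P\<^sub>T (|f|\<^sup>p)\<close>, and integrating against \<open>\<mu>\<^sub>1\<close> yields the contraction property, also for
  unbounded \<open>f\<close>, where the integral exists for almost every \<open>x\<close> only. Uniqueness holds since
  truncations are dense in \<open>L\<^sup>p\<close>.
\<close>

subsection \<open>The space \<open>L\<^sup>p\<close>\<close>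

text \<open>Jensen's inequality for \<open>t powr p\<close>, obtained by integrating a tangent line.
  Integrability of \<open>g\<close> is part of the conclusion because for a kernel only the
  finiteness of the p-th moment is known.\<close>

lemma (in prob_space)
  fixes g :: "'a \<Rightarrow> real"
  assumes p: "1 \<le> p" and g[measurable]: "g \<in> borel_measurable M" and nonneg: "\<And>x. 0 \<le> g x"
    and int: "integrable M (\<lambda>x. g x powr p)"
  shows integrable_of_powr: "integrable M g"
    and expectation_powr_le: "expectation g powr p \<le> expectation (\<lambda>x. g x powr p)"
proof -
  \<comment> \<open>the tangent to \<open>t powr p\<close> at \<open>t = 1\<close>; it is applied below to \<open>g x\<close> divided by its mean\<close>
  have young: "p * t \<le> t powr p + (p - 1)" if "0 \<le> t" for t :: real
  proof (cases "t = 0")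
    case False
    \<comment> \<open>Weighted AM-GM for \<open>t powr p\<close> and 1, with weights
      \<open>1 / p\<close> and \<open>1 - 1 / p\<close>; the left side is \<open>t\<close>.\<close>
    have "(t powr p) powr (1 / p) * 1 powr (1 - 1 / p) \<le> 1 / p * t powr p + (1 - 1 / p) * 1"
      using p that False by (intro Youngs_inequality_0) auto
    then have "t \<le> 1 / p * t powr p + (1 - 1 / p)"
      using p that by (simp add: powr_powr)
    then have "p * t \<le> p * (1 / p * t powr p + (1 - 1 / p))"
      using p by (intro mult_left_mono) auto
    also have "\<dots> = t powr p + (p - 1)"
      using p by (simp add: field_simps)
    finally show ?thesis .
  qed (use p in simp)
  show *: "integrable M g"
  proof (rule Bochner_Integration.integrable_bound)
    show "integrable M (\<lambda>x. g x powr p + (p - 1))"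
      using int by simp
    \<comment> \<open>With \<open>p \<ge> 1\<close> the tangent bound becomes a majorant of
      \<open>g\<close> itself; its constant is integrable because the total mass is finite.\<close>
    have "g x \<le> p * g x" for x
      using p nonneg[of x] by (simp add: mult_le_cancel_right1)
    then have "g x \<le> g x powr p + (p - 1)" for x
      using young[OF nonneg[of x]] by (meson order_trans)
    then show "AE x in M. norm (g x) \<le> norm (g x powr p + (p - 1))"
      using p nonneg by (intro AE_I2) auto
  qed simp
  define m where "m = expectation g"
  show "expectation g powr p \<le> expectation (\<lambda>x. g x powr p)"
  proof (cases "m = 0")
    case True
    then show ?thesis by (simp add: m_def)
  next
    case False
    then have m: "0 < m"
      using Bochner_Integration.integral_nonneg[of M g] nonneg by (simp add: m_def order_less_le)
    have "p * (g x / m) \<le> g x powr p / m powr p + (p - 1)" for x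
      using young[of "g x / m"] nonneg[of x] m by (simp add: powr_divide)
    then have "expectation (\<lambda>x. p * (g x / m)) \<le> expectation (\<lambda>x. g x powr p / m powr p + (p - 1))"
      using * int by (intro integral_mono) auto
    \<comment> \<open>\<open>g / m\<close> has mean 1, so the linear term integrates to
      \<open>p\<close> and the constant \<open>p - 1\<close> then cancels down to 1.\<close>
    then have "p \<le> expectation (\<lambda>x. g x powr p) / m powr p + (p - 1)"
      using * int m by (simp add: m_def[symmetric] prob_space)
    then have "1 \<le> expectation (\<lambda>x. g x powr p) / m powr p"
      by simp
    then show ?thesis
      using m by (simp add: m_def[symmetric] divide_simps)
  qed
qed

text \<open>A sum has norm at most twice the larger summand. This replaces Minkowski's inequality:
  the factor \<open>2 powr p\<close> does no harm where the right side can be made arbitrarily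
  small.\<close>

lemma norm_add_powr_le:
  fixes x y :: "'a::real_normed_vector"
  assumes p: "0 \<le> p"
  shows "norm (x + y) powr p \<le> 2 powr p * (norm x powr p + norm y powr p)"
proof -
  have "norm (x + y) \<le> 2 * max (norm x) (norm y)"
    using norm_triangle_ineq[of x y] by linarith
  then have "norm (x + y) powr p \<le> (2 * max (norm x) (norm y)) powr p"
    using p by (intro powr_mono2) auto
  also have "\<dots> = 2 powr p * max (norm x) (norm y) powr p"
    by (rule powr_mult)
  also have "\<dots> \<le> 2 powr p * (norm x powr p + norm y powr p)"
    by (intro mult_left_mono) (auto simp: max_def)
  finally show ?thesis .
qed

section \<open>Differences, representatives and norms of classes\<close>

lemma lp_fun_diff:
  assumes "p \<ge> 0" "f \<in> lp_fun p M" "g \<in> lp_fun p M"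
  shows "(\<lambda>x. f x - g x) \<in> lp_fun p M"
  using lp_fun_add[OF assms(1,2) lp_fun_scale[OF assms(3), of "- 1"]] by simp

lemma Lp_cases:
  assumes "F \<in> Lp p M"
  obtains f where "f \<in> lp_fun p M" "F = Lp_class p M f"
  using assms by (auto simp: Lp_def Lp_class_def quotient_def)

text \<open>The root \<open>t powr (1 / p)\<close> is strictly increasing on nonnegative reals, so
  norm bounds reduce to bounds between integrals of p-th powers.\<close>

lemma Lp_norm_le_iff:
  assumes "0 < p" and f: "f \<in> lp_fun p M" and g: "g \<in> lp_fun p N"
  shows "Lp_norm p M (Lp_class p M f) \<le> Lp_norm p N (Lp_class p N g) \<longleftrightarrow>
    (\<integral>x. norm (f x) powr p \<partial>M) \<le> (\<integral>x. norm (g x) powr p \<partial>N)"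
proof -
  have "a powr (1 / p) \<le> b powr (1 / p) \<longleftrightarrow> a \<le> b" if "0 \<le> a" "0 \<le> b" for a b :: real
    using that assms(1) powr_less_mono2[of "1 / p" b a] powr_mono2[of "1 / p" a b]
    by (auto simp: not_le[symmetric])
  then show ?thesis
    by (simp add: Lp_norm_class f g)
qed

section \<open>Bounded Borel functions: density and uniqueness of extensions\<close>

lemma bounded_borel_lp_fun:
  assumes "finite_measure M" and sets: "sets M = sets borel" and "0 \<le> p" and f: "f \<in> bounded_borel"
  shows "f \<in> lp_fun p M"
proof -
  interpret finite_measure M by fact
  have [measurable]: "f \<in> borel_measurable M"
    using f by (simp add: bounded_borel_def measurable_cong_sets[OF sets refl])
  obtain B where "\<And>x. norm (f x) \<le> B"
    using f by (auto simp: bounded_borel_def bounded_iff)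
  then have "norm (f x) powr p \<le> B powr p" for x
    using \<open>0 \<le> p\<close> by (intro powr_mono2) auto
  then have "integrable M (\<lambda>x. norm (f x) powr p)"
    by (intro integrable_const_bound[where B = "B powr p"]) auto
  then show ?thesis by (simp add: lp_fun_def)
qed

lemma bounded_borel_dense:
  fixes f :: "'a::topological_space \<Rightarrow> 'k::{real_normed_field, banach, second_countable_topology}"
  assumes sets: "sets M = sets borel" and p: "0 < p" and f: "f \<in> lp_fun p M" and e: "0 < e"
  obtains g where "g \<in> bounded_borel" "g \<in> lp_fun p M" "(\<integral>x. norm (f x - g x) powr p \<partial>M) < e"
proof -
  \<comment> \<open>Cutting off to 0 makes \<open>f - g n\<close> equal to \<open>f\<close> or 0 at
    each point, so \<open>norm (f x) powr p\<close> dominates every difference.\<close>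
  define g where "g n x = (if norm (f x) \<le> real n then f x else 0)" for n x
  have [measurable]: "f \<in> borel_measurable M"
    and int: "integrable M (\<lambda>x. norm (f x) powr p)"
    using f by (auto simp: lp_fun_def)
  have [measurable]: "g n \<in> borel_measurable M" for n
    unfolding g_def by measurable
  have le: "norm (g n x) powr p \<le> norm (f x) powr p" for n x
    by (simp add: g_def)
  have lp: "g n \<in> lp_fun p M" for n
    unfolding lp_fun_def using le
    by (auto intro!: Bochner_Integration.integrable_bound[OF int])
  have bb: "g n \<in> bounded_borel" for n
    unfolding bounded_borel_def
  proof (intro CollectI conjI)
    show "g n \<in> borel_measurable borel"
      using \<open>g n \<in> borel_measurable M\<close> by (simp add: measurable_cong_sets[OF sets refl])
    show "bounded (range (g n))"
      unfolding bounded_iff by (intro exI[of _ "real n"]) (auto simp: g_def)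
  qed
  have "(\<lambda>n. \<integral>x. norm (f x - g n x) powr p \<partial>M) \<longlonglongrightarrow> (\<integral>x. 0 \<partial>M)"
  proof (rule integral_dominated_convergence[OF _ _ int])
    show "AE x in M. (\<lambda>n. norm (f x - g n x) powr p) \<longlonglongrightarrow> 0"
    proof (rule AE_I2)
      fix x
      have "eventually (\<lambda>n. norm (f x) \<le> real n) sequentially"
        by (metis eventually_at_top_linorder real_nat_ceiling_ge of_nat_mono order_trans)
      then have "eventually (\<lambda>n. norm (f x - g n x) powr p = 0) sequentially"
        by eventually_elim (simp add: g_def)
      then show "(\<lambda>n. norm (f x - g n x) powr p) \<longlonglongrightarrow> 0"
        by (rule tendsto_eventually)
    qed
    show "AE x in M. norm (norm (f x - g n x) powr p) \<le> norm (f x) powr p" for n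
      by (simp add: g_def)
  qed auto
  then have "eventually (\<lambda>n. (\<integral>x. norm (f x - g n x) powr p \<partial>M) < e) sequentially"
    using e by (intro order_tendstoD(2)) auto
  then obtain n where "(\<integral>x. norm (f x - g n x) powr p \<partial>M) < e"
    by (auto simp: eventually_sequentially)
  with bb lp that show thesis by blast
qed

text \<open>The difference is written as \<open>f + (- 1) * g\<close>, so that additivity and
  homogeneity of \<open>S\<close> carry over to it; then the norm bound applies.\<close>

lemma Lp_linear_contraction_diff:
  assumes "Lp_linear_contraction p M N S" and p: "0 < p"
    and f: "f \<in> lp_fun p M" and g: "g \<in> lp_fun p M"
    and u: "u \<in> lp_fun p N" "S (Lp_class p M f) = Lp_class p N u"
    and v: "v \<in> lp_fun p N" "S (Lp_class p M g) = Lp_class p N v"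
  shows "(\<integral>x. norm (u x - v x) powr p \<partial>N) \<le> (\<integral>x. norm (f x - g x) powr p \<partial>M)"
proof -
  note S = assms(1)[unfolded Lp_linear_contraction_def]
  have m: "(\<lambda>x. (- 1) * g x) \<in> lp_fun p M" "(\<lambda>x. (- 1) * v x) \<in> lp_fun p N"
    by (intro lp_fun_scale g v)+
  have add: "S (Lp_add p M F G) = Lp_add p N (S F) (S G)" if "F \<in> Lp p M" "G \<in> Lp p M" for F G
    using S that by blast
  have scale: "S (Lp_scale p M c F) = Lp_scale p N c (S F)" if "F \<in> Lp p M" for c F
    using S that by blast
  have "S (Lp_class p M (\<lambda>x. (- 1) * g x)) = Lp_class p N (\<lambda>x. (- 1) * v x)"
    using scale[OF Lp_class_in_Lp[OF g], of "- 1"]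
    by (simp only: v(2) Lp_scale_class[OF g] Lp_scale_class[OF v(1)])
  then have "S (Lp_class p M (\<lambda>x. f x + (- 1) * g x)) = Lp_class p N (\<lambda>x. u x + (- 1) * v x)"
    using add[OF Lp_class_in_Lp[OF f] Lp_class_in_Lp[OF m(1)]] p
    by (simp only: u(2) Lp_add_class[OF less_imp_le f m(1)] Lp_add_class[OF less_imp_le u(1) m(2)])
  then have "S (Lp_class p M (\<lambda>x. f x - g x)) = Lp_class p N (\<lambda>x. u x - v x)"
    by simp
  moreover have d: "(\<lambda>x. f x - g x) \<in> lp_fun p M" "(\<lambda>x. u x - v x) \<in> lp_fun p N"
    using p f g u v by (auto intro: lp_fun_diff)
  ultimately have "Lp_norm p N (Lp_class p N (\<lambda>x. u x - v x)) \<le> Lp_norm p M (Lp_class p M (\<lambda>x. f x - g x))"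
    using S Lp_class_in_Lp by metis
  then show ?thesis
    using d p by (simp add: Lp_norm_le_iff)
qed

text \<open>Density argument: approximate \<open>f\<close> by a bounded \<open>g\<close>. Both
  images of \<open>f\<close> are then close to the common image \<open>v\<close> of
  \<open>g\<close>, hence to each other.\<close>

lemma Lp_linear_contraction_eq:
  fixes S S' :: "('a::topological_space \<Rightarrow> 'k::{real_normed_field, banach, second_countable_topology}) set
    \<Rightarrow> ('b \<Rightarrow> 'k) set"
  assumes sets: "sets M = sets borel" and p: "0 < p"
    and S: "Lp_linear_contraction p M N S" and S': "Lp_linear_contraction p M N S'"
    and eq: "\<And>f. f \<in> bounded_borel \<Longrightarrow> f \<in> lp_fun p M \<Longrightarrow> S (Lp_class p M f) = S' (Lp_class p M f)"
    and F: "F \<in> Lp p M"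
  shows "S F = S' F"
proof -
  have in_Lp: "S G \<in> Lp p N" "S' G \<in> Lp p N" if "G \<in> Lp p M" for G
    using S S' that by (auto simp: Lp_linear_contraction_def)
  obtain f where f: "f \<in> lp_fun p M" "F = Lp_class p M f"
    using F by (rule Lp_cases)
  obtain u where u: "u \<in> lp_fun p N" "S F = Lp_class p N u"
    using in_Lp(1)[OF F] by (rule Lp_cases)
  obtain u' where u': "u' \<in> lp_fun p N" "S' F = Lp_class p N u'"
    using in_Lp(2)[OF F] by (rule Lp_cases)
  have int: "integrable N (\<lambda>x. norm (h x - k x) powr p)"
    if "h \<in> lp_fun p N" "k \<in> lp_fun p N" for h k :: "'b \<Rightarrow> 'k"
    using lp_fun_diff[of p h N k] that p by (auto simp: lp_fun_def)
  define I where "I = (\<integral>x. norm (u x - u' x) powr p \<partial>N)"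
  \<comment> \<open>The summand 0 gives the shape that \<open>field_le_epsilon\<close>
    expects.\<close>
  have "I \<le> 0 + e" if e: "0 < e" for e
  proof -
    \<comment> \<open>Chosen so that \<open>2 powr p * (d + d) = e\<close>.\<close>
    define d where "d = e / (2 * 2 powr p)"
    have "0 < d" using e by (simp add: d_def)
    then obtain g where g: "g \<in> bounded_borel" "g \<in> lp_fun p M"
      and gd: "(\<integral>x. norm (f x - g x) powr p \<partial>M) < d"
      using bounded_borel_dense[OF sets p f(1)] by metis
    obtain v where v: "v \<in> lp_fun p N" "S (Lp_class p M g) = Lp_class p N v"
      using in_Lp(1)[OF Lp_class_in_Lp[OF g(2)]] by (rule Lp_cases)
    have v': "S' (Lp_class p M g) = Lp_class p N v"
      using eq[OF g] v by simp
    have 1: "(\<integral>x. norm (u x - v x) powr p \<partial>N) \<le> d"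
      using Lp_linear_contraction_diff[OF S p f(1) g(2) u(1) _ v] u(2) f(2) gd by simp
    have 2: "(\<integral>x. norm (u' x - v x) powr p \<partial>N) \<le> d"
      using Lp_linear_contraction_diff[OF S' p f(1) g(2) u'(1) _ v(1) v'] u'(2) f(2) gd by simp
    have "norm (u x - u' x) powr p \<le> 2 powr p * (norm (u x - v x) powr p + norm (u' x - v x) powr p)" for x
      using norm_add_powr_le[of p "u x - v x" "v x - u' x"] p by (simp add: norm_minus_commute)
    then have "I \<le> (\<integral>x. 2 powr p * (norm (u x - v x) powr p + norm (u' x - v x) powr p) \<partial>N)"
      unfolding I_def using int[OF u(1) u'(1)] int[OF u(1) v(1)] int[OF u'(1) v(1)]
      by (intro integral_mono) auto
    also have "\<dots> = 2 powr p * ((\<integral>x. norm (u x - v x) powr p \<partial>N) + (\<integral>x. norm (u' x - v x) powr p \<partial>N))"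
      using int[OF u(1) v(1)] int[OF u'(1) v(1)] by simp
    also have "\<dots> \<le> 2 powr p * (d + d)"
      using 1 2 by (intro mult_left_mono add_mono) auto
    also have "\<dots> = e" by (simp add: d_def)
    finally show ?thesis by simp
  qed
  then have "I \<le> 0" by (rule field_le_epsilon)
  moreover have "0 \<le> I" unfolding I_def by simp
  ultimately have "(\<integral>x. norm (u x - u' x) powr p \<partial>N) = 0"
    unfolding I_def by simp
  then have "AE x in N. norm (u x - u' x) powr p = 0"
    using int[OF u(1) u'(1)] by (subst (asm) integral_nonneg_eq_0_iff_AE) auto
  then have "AE x in N. u x = u' x"
    by eventually_elim simp
  then show ?thesis
    using u u' by (simp add: Lp_class_eq_iff)
qed

subsection \<open>Markov operators\<close>

text \<open>\<open>M\<close> is the law of the starting point and \<open>N\<close> carries the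
  target sigma-algebra. The law after one step is \<open>M \<bind> Q\<close>, so the operator goes
  from functions on \<open>M \<bind> Q\<close> back to functions on \<open>M\<close>.\<close>

locale markov_kernel = M?: prob_space M
  for M :: "'a measure" and N :: "'b measure" and Q :: "'a \<Rightarrow> 'b measure" +
  assumes kernel: "Q \<in> M \<rightarrow>\<^sub>M prob_algebra N"
begin

lemma kernel_subprob [measurable]: "Q \<in> M \<rightarrow>\<^sub>M subprob_algebra N"
  using kernel by (rule measurable_prob_algebraD)

lemma sets_kernel_at: "x \<in> space M \<Longrightarrow> sets (Q x) = sets N"
  using measurable_space[OF kernel] by (simp add: space_prob_algebra)

lemma prob_space_kernel: "x \<in> space M \<Longrightarrow> prob_space (Q x)"
  using measurable_space[OF kernel] by (simp add: space_prob_algebra)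

lemma sets_bind_kernel: "sets (M \<bind> Q) = sets N"
  using M.not_empty by (simp add: sets_bind[OF sets_kernel_at])

lemma measurable_bind_kernel_iff: "f \<in> measurable (M \<bind> Q) L \<longleftrightarrow> f \<in> measurable N L"
  by (simp add: measurable_cong_sets[OF sets_bind_kernel refl])

lemma measurable_kernel_at: "x \<in> space M \<Longrightarrow> f \<in> measurable N L \<Longrightarrow> f \<in> measurable (Q x) L"
  by (simp add: measurable_cong_sets[OF sets_kernel_at refl])

text \<open>A total function: where \<open>f\<close> is not integrable for \<open>Q x\<close>, the
  Bochner integral has the default value 0.\<close>

definition markov_op :: "('b \<Rightarrow> 'k::{real_normed_field, banach, second_countable_topology}) \<Rightarrow> 'a \<Rightarrow> 'k"
  where "markov_op f x = (\<integral>y. f y \<partial>Q x)"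

lemma markov_op_measurable:
  assumes [measurable]: "f \<in> borel_measurable N"
  shows "markov_op f \<in> borel_measurable M"
  unfolding markov_op_def[abs_def]
  by (rule measurable_compose[OF kernel_subprob integral_measurable_subprob_algebra]) fact

text \<open>A null set of \<open>M \<bind> Q\<close> is null for \<open>Q x\<close> at almost every
  \<open>x\<close>. Hence the operator is well defined on classes.\<close>

lemma markov_op_cong_AE:
  assumes [measurable]: "f \<in> borel_measurable N" "g \<in> borel_measurable N"
    and eq: "AE y in M \<bind> Q. f y = g y"
  shows "AE x in M. markov_op f x = markov_op g x"
proof -
  have "AE x in M. AE y in Q x. f y = g y"
    using eq by (subst (asm) AE_bind[OF kernel_subprob]) auto
  then show ?thesis
    unfolding markov_op_def
    by (rule AE_mp[OF _ AE_I2]) (auto intro!: integral_cong_AE intro: measurable_kernel_at)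
qed

text \<open>The p-th moment under \<open>M \<bind> Q\<close> is the \<open>M\<close>-integral of the
  moments under \<open>Q x\<close>, and a function with finite integral is finite almost
  everywhere.\<close>

lemma lp_fun_kernel_AE:
  assumes f: "f \<in> lp_fun p (M \<bind> Q)"
  shows "AE x in M. f \<in> lp_fun p (Q x)"
proof -
  have [measurable]: "f \<in> borel_measurable N"
    using f by (simp add: lp_fun_def measurable_bind_kernel_iff)
  have "integrable (M \<bind> Q) (\<lambda>y. norm (f y) powr p)"
    using f by (simp add: lp_fun_def)
  then have "(\<integral>\<^sup>+x. \<integral>\<^sup>+y. norm (f y) powr p \<partial>Q x \<partial>M) < \<infinity>"
    by (simp add: integrable_iff_bounded nn_integral_bind[OF _ kernel_subprob])
  then have "AE x in M. (\<integral>\<^sup>+y. norm (f y) powr p \<partial>Q x) \<noteq> \<infinity>"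
    by (intro nn_integral_PInf_AE
        measurable_compose[OF kernel_subprob nn_integral_measurable_subprob_algebra]) auto
  then show ?thesis
    by (rule AE_mp[OF _ AE_I2])
      (auto simp: lp_fun_def integrable_iff_bounded less_top intro!: measurable_kernel_at)
qed

lemma
  assumes p: "1 \<le> p" and f: "f \<in> lp_fun p (M \<bind> Q)"
  shows markov_op_lp_fun: "markov_op f \<in> lp_fun p M"
    and markov_op_contraction:
      "(\<integral>x. norm (markov_op f x) powr p \<partial>M) \<le> (\<integral>y. norm (f y) powr p \<partial>(M \<bind> Q))"
proof -
  have [measurable]: "f \<in> borel_measurable N"
    using f by (simp add: lp_fun_def measurable_bind_kernel_iff)
  note [measurable] = markov_op_measurable[OF this]
  have int: "integrable (M \<bind> Q) (\<lambda>y. norm (f y) powr p)"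
    using f by (simp add: lp_fun_def)
  \<comment> \<open>Jensen at a single point, stated in \<open>ennreal\<close>: integrability of the
    left side over \<open>M\<close> is then a result of the estimate, not a prerequisite.\<close>
  have "ennreal (norm (markov_op f x) powr p) \<le> (\<integral>\<^sup>+y. norm (f y) powr p \<partial>Q x)"
    if x: "x \<in> space M" and fx: "f \<in> lp_fun p (Q x)" for x
  proof -
    interpret Q: prob_space "Q x" using x by (rule prob_space_kernel)
    have [measurable]: "f \<in> borel_measurable (Q x)" and
      ix: "integrable (Q x) (\<lambda>y. norm (f y) powr p)"
      using fx by (auto simp: lp_fun_def)
    have "norm (markov_op f x) powr p \<le> (\<integral>y. norm (f y) \<partial>Q x) powr p"
      unfolding markov_op_def using p by (intro powr_mono2 integral_norm_bound) auto
    also have "\<dots> \<le> (\<integral>y. norm (f y) powr p \<partial>Q x)"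
      using p ix by (intro Q.expectation_powr_le) auto
    finally show ?thesis
      using ix by (simp add: nn_integral_eq_integral ennreal_leI)
  qed
  then have "(\<integral>\<^sup>+x. norm (markov_op f x) powr p \<partial>M) \<le> (\<integral>\<^sup>+x. \<integral>\<^sup>+y. norm (f y) powr p \<partial>Q x \<partial>M)"
    using lp_fun_kernel_AE[OF f] by (intro nn_integral_mono_AE) auto
  also have "\<dots> = (\<integral>\<^sup>+y. norm (f y) powr p \<partial>(M \<bind> Q))"
    by (simp add: nn_integral_bind[OF _ kernel_subprob])
  also have "\<dots> = ennreal (\<integral>y. norm (f y) powr p \<partial>(M \<bind> Q))"
    using int by (simp add: nn_integral_eq_integral)
  finally have le: "(\<integral>\<^sup>+x. norm (markov_op f x) powr p \<partial>M) \<le> ennreal (\<integral>y. norm (f y) powr p \<partial>(M \<bind> Q))" .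
  then have i: "integrable M (\<lambda>x. norm (markov_op f x) powr p)"
    by (simp add: integrable_iff_bounded le_less_trans[OF le])
  then show "markov_op f \<in> lp_fun p M"
    by (simp add: lp_fun_def)
  show "(\<integral>x. norm (markov_op f x) powr p \<partial>M) \<le> (\<integral>y. norm (f y) powr p \<partial>(M \<bind> Q))"
    using le i by (simp add: nn_integral_eq_integral)
qed

text \<open>The identity can fail where the default value 0 enters, hence only almost everywhere. At
  almost every \<open>x\<close> the p-th moments are finite, which gives integrability for the
  probability measure \<open>Q x\<close>.\<close>

lemma markov_op_add_AE:
  fixes f g :: "'b \<Rightarrow> 'k::{real_normed_field, banach, second_countable_topology}"
  assumes p: "1 \<le> p" and f: "f \<in> lp_fun p (M \<bind> Q)" and g: "g \<in> lp_fun p (M \<bind> Q)"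
  shows "AE x in M. markov_op (\<lambda>y. f y + g y) x = markov_op f x + markov_op g x"
proof -
  have int: "integrable (Q x) h" if "x \<in> space M" "h \<in> lp_fun p (Q x)" for x and h :: "'b \<Rightarrow> 'k"
  proof -
    interpret Q: prob_space "Q x" using that(1) by (rule prob_space_kernel)
    have "integrable (Q x) (\<lambda>y. norm (h y))"
      by (rule Q.integrable_of_powr[OF p]) 
        (use that(2) in \<open>auto simp: lp_fun_def intro: borel_measurable_norm\<close>)
    then show ?thesis
      using that(2) by (simp add: lp_fun_def integrable_norm_iff)
  qed
  show ?thesis
    using lp_fun_kernel_AE[OF f] lp_fun_kernel_AE[OF g] AE_space[of M]
    by eventually_elim (simp add: markov_op_def int)
qed

text \<open>Valid at every point: where \<open>f\<close> is not integrable, both sides are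
  0.\<close>

lemma markov_op_scale: "markov_op (\<lambda>y. c * f y) x = c * markov_op f x"
  by (simp add: markov_op_def)

theorem markov_op_extends:
  assumes p: "1 \<le> p"
  obtains S :: "('b \<Rightarrow> 'k::{real_normed_field, banach, second_countable_topology}) set \<Rightarrow> ('a \<Rightarrow> 'k) set"
  where "S \<in> extensional (Lp p (M \<bind> Q))" "Lp_linear_contraction p (M \<bind> Q) M S"
    "\<And>f. f \<in> lp_fun p (M \<bind> Q) \<Longrightarrow> S (Lp_class p (M \<bind> Q) f) = Lp_class p M (markov_op f)"
proof -
  let ?L = "lp_fun p (M \<bind> Q) :: ('b \<Rightarrow> 'k) set"
  let ?cl = "Lp_class p (M \<bind> Q) :: ('b \<Rightarrow> 'k) \<Rightarrow> _"
  \<comment> \<open>All representatives yield the same class, so the union collapses to it.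
    \<open>restrict\<close> fixes the value outside \<open>Lp\<close>.\<close>
  define S where "S = restrict (\<lambda>F :: ('b \<Rightarrow> 'k) set. \<Union>f\<in>F. Lp_class p M (markov_op f)) (Lp p (M \<bind> Q))"
  have S: "S (?cl f) = Lp_class p M (markov_op f)" if f: "f \<in> ?L" for f
  proof -
    have "Lp_class p M (markov_op g) = Lp_class p M (markov_op f)" if "g \<in> ?cl f" for g
    proof -
      have g: "g \<in> ?L" "AE y in M \<bind> Q. g y = f y"
        using that by (auto simp: mem_Lp_class_iff)
      then have "AE x in M. markov_op g x = markov_op f x"
        using f by (intro markov_op_cong_AE) (auto simp: lp_fun_def measurable_bind_kernel_iff)
      then show ?thesis
        using p f g by (simp add: Lp_class_eq_iff markov_op_lp_fun)
    qed
    moreover have "f \<in> ?cl f"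
      using f by (simp add: mem_Lp_class_iff)
    ultimately have "(\<Union>g\<in>?cl f. Lp_class p M (markov_op g)) = Lp_class p M (markov_op f)"
      by blast
    then show ?thesis
      using f by (simp add: S_def Lp_class_in_Lp)
  qed
  have 1: "S F \<in> Lp p M" if "F \<in> Lp p (M \<bind> Q)" for F
    using that p by (auto elim!: Lp_cases simp: S intro!: Lp_class_in_Lp markov_op_lp_fun)
  have 2: "S (Lp_add p (M \<bind> Q) F G) = Lp_add p M (S F) (S G)"
    if F: "F \<in> Lp p (M \<bind> Q)" and G: "G \<in> Lp p (M \<bind> Q)" for F G
  proof -
    obtain f where f: "f \<in> ?L" "F = ?cl f" using F by (rule Lp_cases)
    obtain g where g: "g \<in> ?L" "G = ?cl g" using G by (rule Lp_cases)
    show ?thesis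
      using p f g markov_op_add_AE[OF p f(1) g(1)]
      by (simp add: Lp_add_class S lp_fun_add markov_op_lp_fun Lp_class_eq_iff)
  qed
  have 3: "S (Lp_scale p (M \<bind> Q) c F) = Lp_scale p M c (S F)" if F: "F \<in> Lp p (M \<bind> Q)" for c F
  proof -
    obtain f where f: "f \<in> ?L" "F = ?cl f" using F by (rule Lp_cases)
    show ?thesis
      using p f by (simp add: Lp_scale_class S lp_fun_scale markov_op_lp_fun Lp_class_eq_iff markov_op_scale)
  qed
  have 4: "Lp_norm p M (S F) \<le> Lp_norm p (M \<bind> Q) F" if F: "F \<in> Lp p (M \<bind> Q)" for F
  proof -
    obtain f where f: "f \<in> ?L" "F = ?cl f" using F by (rule Lp_cases)
    show ?thesis
      using p f by (simp add: S Lp_norm_le_iff markov_op_lp_fun markov_op_contraction)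
  qed
  show thesis
  proof (rule that)
    show "S \<in> extensional (Lp p (M \<bind> Q))" by (simp add: S_def)
    show "Lp_linear_contraction p (M \<bind> Q) M S"
      unfolding Lp_linear_contraction_def using 1 2 3 4 by blast
  qed (rule S)
qed

end

subsection \<open>Translation kernels\<close>

lemma borel_measurable_plus_const:
  "(\<lambda>y. x + y) \<in> borel_measurable (borel :: 'a::real_normed_vector measure)"
  by (intro borel_measurable_continuous_onI continuous_intros)

text \<open>Measurability in the translation parameter is
  \<open>measurable_emeasure_translate\<close>, which avoids joint measurability of addition and so
  covers non-separable spaces.\<close>

lemma translation_kernel:
  fixes \<rho> :: "'b::real_normed_vector measure"
  assumes "prob_space \<rho>" and sets: "sets \<rho> = sets borel"
  shows "(\<lambda>x. distr \<rho> borel (\<lambda>y. x + y)) \<in> borel \<rightarrow>\<^sub>M prob_algebra borel"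
proof -
  interpret prob_space \<rho> by fact
  have m: "(\<lambda>y. x + y) \<in> measurable \<rho> borel" for x
    using borel_measurable_plus_const by (simp add: measurable_cong_sets[OF sets refl])
  have P: "prob_space (distr \<rho> borel (\<lambda>y. x + y))" for x
    using m by (rule prob_space_distr)
  have "space \<rho> = UNIV"
    using sets_eq_imp_space_eq[OF sets] by simp
  then have "(\<lambda>x. emeasure (distr \<rho> borel (\<lambda>y. x + y)) A) \<in> borel_measurable borel"
    if "A \<in> sets borel" for A
    using measurable_emeasure_translate[OF finite_measure_axioms sets that] that
    by (simp add: emeasure_distr[OF m] vimage_def)
  then show ?thesis
    using P by (intro measurable_prob_algebraI measurable_subprob_algebra)
      (auto intro: prob_space_imp_subprob_space)
qed

text \<open>Both sides assign to \<open>A\<close> the integral over \<open>\<mu>\<close> of the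
  \<open>\<rho>\<close>-measure of \<open>A\<close> translated by \<open>- x\<close>.\<close>

lemma conv_measure_eq_bind:
  fixes \<mu> \<rho> :: "'b::real_normed_vector measure"
  assumes "prob_space \<rho>" and sets: "sets \<mu> = sets borel" "sets \<rho> = sets borel"
  shows "conv_measure \<mu> \<rho> = \<mu> \<bind> (\<lambda>x. distr \<rho> borel (\<lambda>y. x + y))"
proof (rule measure_eqI)
  interpret prob_space \<rho> by fact
  have space: "space \<mu> = UNIV" "space \<rho> = UNIV"
    using sets by (auto dest: sets_eq_imp_space_eq)
  then show "sets (conv_measure \<mu> \<rho>) = sets (\<mu> \<bind> (\<lambda>x. distr \<rho> borel (\<lambda>y. x + y)))"
    by (simp add: sets_bind[where N = borel])
  fix A assume "A \<in> sets (conv_measure \<mu> \<rho>)"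
  then have A: "A \<in> sets borel" by simp
  have "(\<lambda>x. distr \<rho> borel (\<lambda>y. x + y)) \<in> \<mu> \<rightarrow>\<^sub>M subprob_algebra borel"
    using measurable_prob_algebraD[OF translation_kernel[OF assms(1) sets(2)]]
    by (simp add: measurable_cong_sets[OF sets(1) refl])
  moreover have "(\<lambda>y. x + y) \<in> measurable \<rho> borel" for x
    using borel_measurable_plus_const by (simp add: measurable_cong_sets[OF sets(2) refl])
  ultimately show "emeasure (conv_measure \<mu> \<rho>) A =
      emeasure (\<mu> \<bind> (\<lambda>x. distr \<rho> borel (\<lambda>y. x + y))) A"
    using A space
    by (simp add: emeasure_conv_measure[OF finite_measure_axioms sets A] emeasure_bind
        emeasure_distr vimage_def)
qed

text \<open>An operator \<open>S\<close> is a total function on sets of functions. Membership in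
  \<open>extensional\<close> fixes its values outside \<open>Lp\<close>, so that uniqueness can be
  stated as equality of functions.\<close>

theorem proposition2p2:
  fixes \<mu>\<^sub>1 :: "'a::banach measure" and \<mu>\<^sub>2 \<rho> :: "'b::banach measure" and T :: "'a \<Rightarrow> 'b"
    and P :: "('b \<Rightarrow> 'k::{real_normed_field, banach, second_countable_topology}) \<Rightarrow> 'a \<Rightarrow> 'k"
  assumes "radon_prob \<mu>\<^sub>1" and "radon_prob \<mu>\<^sub>2"
    and "\<And>x'. char_fun \<mu>\<^sub>2 x' \<noteq> 0"
    and "skew_map T \<mu>\<^sub>1 \<mu>\<^sub>2"
    and "skew_factor T \<mu>\<^sub>1 \<mu>\<^sub>2 \<rho>"
  defines "P \<equiv> skew_op T \<rho>"
  shows "(\<forall>f\<in>bounded_borel. P f \<in> bounded_borel) \<and>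
    (\<forall>f\<in>bounded_borel. \<forall>g\<in>bounded_borel. P (\<lambda>y. f y + g y) = (\<lambda>x. P f x + P g x)) \<and>
    (\<forall>c. \<forall>f\<in>bounded_borel. P (\<lambda>y. c * f y) = (\<lambda>x. c * P f x)) \<and>
    (\<forall>p\<ge>1. \<exists>!S. S \<in> extensional (Lp p \<mu>\<^sub>2) \<and> Lp_linear_contraction p \<mu>\<^sub>2 \<mu>\<^sub>1 S \<and>
       (\<forall>f\<in>bounded_borel. S (Lp_class p \<mu>\<^sub>2 f) = Lp_class p \<mu>\<^sub>1 (P f)))"
proof -
  have "prob_space \<mu>\<^sub>1" "prob_space \<mu>\<^sub>2" "prob_space \<rho>"
    and sets: "sets \<mu>\<^sub>1 = sets borel" "sets \<mu>\<^sub>2 = sets borel" "sets \<rho> = sets borel"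
    using assms(1,2,5) by (auto simp: radon_prob_def skew_factor_def)
  interpret \<mu>1: prob_space \<mu>\<^sub>1 by fact
  interpret \<mu>2: prob_space \<mu>\<^sub>2 by fact
  interpret \<rho>: prob_space \<rho> by fact
  define Q where "Q x = distr \<rho> borel (\<lambda>y. T x + y)" for x
  have [measurable]: "T \<in> borel_measurable borel"
    using assms(4) by (simp add: skew_map_def)
  then have T: "T \<in> borel_measurable \<mu>\<^sub>1"
    by (simp add: measurable_cong_sets[OF sets(1) refl])
  have translation: "(\<lambda>x. distr \<rho> borel (\<lambda>y. x + y)) \<in> borel \<rightarrow>\<^sub>M prob_algebra borel"
    by (rule translation_kernel) fact+
  interpret markov_kernel \<mu>\<^sub>1 borel Q
    by unfold_locales (use measurable_compose[OF T translation] in \<open>simp add: Q_def[abs_def]\<close>)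
  have "\<mu>\<^sub>2 = conv_measure (distr \<mu>\<^sub>1 borel T) \<rho>"
    using assms(5) by (simp add: skew_factor_def)
  also have "\<dots> = distr \<mu>\<^sub>1 borel T \<bind> (\<lambda>x. distr \<rho> borel (\<lambda>y. x + y))"
    by (rule conv_measure_eq_bind) (simp_all add: sets \<rho>.prob_space_axioms)
  \<comment> \<open>The map \<open>T\<close> moves from the image measure into the kernel.\<close>
  also have "\<dots> = \<mu>\<^sub>1 \<bind> Q"
    unfolding Q_def[abs_def]
    by (rule bind_distr[OF T measurable_prob_algebraD[OF translation] \<mu>1.not_empty])
  finally have bind: "\<mu>\<^sub>1 \<bind> Q = \<mu>\<^sub>2" by simp
  have shift: "(\<lambda>y. x + y) \<in> measurable \<rho> borel" for x
    using borel_measurable_plus_const by (simp add: measurable_cong_sets[OF sets(3) refl])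
  have op: "P f = markov_op f" if "f \<in> bounded_borel" for f :: "'b \<Rightarrow> 'k"
    using that shift
    by (auto simp: P_def skew_op_def markov_op_def Q_def bounded_borel_def integral_distr)
  have int: "integrable \<rho> (\<lambda>y. f (x + y))" if f: "f \<in> bounded_borel" for f :: "'b \<Rightarrow> 'k" and x
  proof -
    obtain B where "\<And>y. norm (f y) \<le> B"
      using f by (auto simp: bounded_borel_def bounded_iff)
    moreover have "(\<lambda>y. f (x + y)) \<in> borel_measurable \<rho>"
      using f by (intro measurable_compose[OF shift]) (simp add: bounded_borel_def)
    ultimately show ?thesis
      by (intro \<rho>.integrable_const_bound[where B = B]) auto
  qed
  have "P f \<in> bounded_borel" if f: "f \<in> bounded_borel" for f
    unfolding bounded_borel_def
  proof (intro CollectI conjI)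
    \<comment> \<open>Taken from the operator of the kernel, since \<mu>1 has exactly the Borel sets
      as its sigma-algebra.\<close>
    show "P f \<in> borel_measurable borel"
      using markov_op_measurable[of f] f
      by (simp add: op bounded_borel_def measurable_cong_sets[OF sets(1) refl])
    obtain B where B: "\<And>y. norm (f y) \<le> B"
      using f by (auto simp: bounded_borel_def bounded_iff)
    have "norm (P f x) \<le> B" for x
    proof -
      have "norm (P f x) \<le> (\<integral>y. norm (f (T x + y)) \<partial>\<rho>)"
        unfolding P_def skew_op_def by (rule integral_norm_bound)
      also have "\<dots> \<le> (\<integral>y. B \<partial>\<rho>)"
        using int[OF f] B by (intro integral_mono) auto
      finally show ?thesis by (simp add: \<rho>.prob_space)
    qed
    then show "bounded (range (P f))"
      by (auto simp: bounded_iff)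
  qed
  moreover have "P (\<lambda>y. f y + g y) = (\<lambda>x. P f x + P g x)"
    if "f \<in> bounded_borel" "g \<in> bounded_borel" for f g
    using int that by (simp add: P_def skew_op_def)
  moreover have "P (\<lambda>y. c * f y) = (\<lambda>x. c * P f x)" for c f
    by (simp add: P_def skew_op_def)
  moreover have "\<exists>!S. S \<in> extensional (Lp p \<mu>\<^sub>2) \<and> Lp_linear_contraction p \<mu>\<^sub>2 \<mu>\<^sub>1 S \<and>
       (\<forall>f\<in>bounded_borel. S (Lp_class p \<mu>\<^sub>2 f) = Lp_class p \<mu>\<^sub>1 (P f))"
    (is "\<exists>!S. ?ext S \<and> ?contr S \<and> ?agree S") if p: "1 \<le> p" for p
  proof -
    have lp: "f \<in> lp_fun p \<mu>\<^sub>2" if "f \<in> bounded_borel" for f :: "'b \<Rightarrow> 'k"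
      using p that by (intro bounded_borel_lp_fun sets \<mu>2.finite_measure_axioms) auto
    obtain S :: "('b \<Rightarrow> 'k) set \<Rightarrow> ('a \<Rightarrow> 'k) set" where S: "?ext S" "?contr S"
      "\<And>f. f \<in> lp_fun p \<mu>\<^sub>2 \<Longrightarrow> S (Lp_class p \<mu>\<^sub>2 f) = Lp_class p \<mu>\<^sub>1 (markov_op f)"
      using markov_op_extends[OF p] unfolding bind by blast
    show ?thesis
    proof (rule ex1I[of _ S])
      show *: "?ext S \<and> ?contr S \<and> ?agree S"
        using S lp op by simp
      fix S' assume S': "?ext S' \<and> ?contr S' \<and> ?agree S'"
      show "S' = S"
      proof (rule extensionalityI[of _ "Lp p \<mu>\<^sub>2"])
        fix F :: "('b \<Rightarrow> 'k) set" assume F: "F \<in> Lp p \<mu>\<^sub>2"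
        show "S' F = S F"
          \<comment> \<open>On bounded Borel functions both operators are given by \<open>P\<close>,
            so density settles every class in \<open>Lp\<close>; outside it both are
            \<open>undefined\<close>.\<close>
          by (rule Lp_linear_contraction_eq[OF sets(2) _ _ _ _ F]) (use * S' p in auto)
      qed (use * S' in auto)
    qed
  qed
  ultimately show ?thesis by blast
qed

end
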